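(* There is an absolute constant $c>0$ such that for all integers $1\le k\le d$ there exists a finite transitive subset $X$ of the unit sphere in $\mathbb{R}^d$ such that for every $k$-dimensional subspace $W$ (either a real subspace of $\mathbb{R}^d$ or a complex subspace of $\mathbb{C}^d\supseteq\mathbb{R}^d$) one has \[\sup_{\mathbf{x}\in X}\|\mathrm{proj}_W\mathbf{x}\|_2\ge \frac{c}{\sqrt{\log(2d/k)}}.\]
   Context: A subset $X$ of the unit sphere of $\mathbb{R}^d$ is transitive if for every $x,x'\in X$ there is $g\in\mathsf{O}(\mathbb{R}^d)$ with $gX=X$ and $gx=x'$. $\mathrm{proj}_W$ denotes orthogonal projection onto $W$. *)

theory Defs
  imports Complex_Main
begin

text \<open>Coordinates: a vector of \<open>\<bbbk>^d\<close> is a function \<open>nat \<Rightarrow> \<bbbk>\<close>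
  vanishing outside \<open>{..<d}\<close>.  This lets the dimension d be quantified inside
  the statement (the constant c is absolute, i.e. independent of d).\<close>

definition coord_space :: "nat \<Rightarrow> (nat \<Rightarrow> 'a::zero) set" where
  "coord_space d = {x. \<forall>i\<ge>d. x i = 0}"

definition lincomb :: "nat \<Rightarrow> (nat \<Rightarrow> 'a::comm_ring_1) \<Rightarrow> (nat \<Rightarrow> nat \<Rightarrow> 'a) \<Rightarrow> nat \<Rightarrow> 'a" where
  "lincomb k a b = (\<lambda>i. \<Sum>j<k. a j * b j i)"

definition ksubspace :: "nat \<Rightarrow> nat \<Rightarrow> (nat \<Rightarrow> 'a::field) set \<Rightarrow> bool" where
  "ksubspace d k W \<longleftrightarrow>
     (\<exists>b. (\<forall>j<k. b j \<in> coord_space d)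
        \<and> (\<forall>a. lincomb k a b = (\<lambda>_. 0) \<longrightarrow> (\<forall>j<k. a j = 0))
        \<and> W = {lincomb k a b | a. True})"

definition rinner :: "nat \<Rightarrow> (nat \<Rightarrow> real) \<Rightarrow> (nat \<Rightarrow> real) \<Rightarrow> real" where
  "rinner d x y = (\<Sum>i<d. x i * y i)"

definition rnorm :: "nat \<Rightarrow> (nat \<Rightarrow> real) \<Rightarrow> real" where
  "rnorm d x = sqrt (rinner d x x)"

definition cinner :: "nat \<Rightarrow> (nat \<Rightarrow> complex) \<Rightarrow> (nat \<Rightarrow> complex) \<Rightarrow> complex" where
  "cinner d x y = (\<Sum>i<d. x i * cnj (y i))"

definition cnorm :: "nat \<Rightarrow> (nat \<Rightarrow> complex) \<Rightarrow> real" where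
  "cnorm d x = sqrt (\<Sum>i<d. (cmod (x i))\<^sup>2)"

definition rproj :: "nat \<Rightarrow> (nat \<Rightarrow> real) set \<Rightarrow> (nat \<Rightarrow> real) \<Rightarrow> (nat \<Rightarrow> real)" where
  "rproj d W x = (THE w. w \<in> W \<and> (\<forall>u\<in>W. rinner d (\<lambda>i. x i - w i) u = 0))"

definition cproj :: "nat \<Rightarrow> (nat \<Rightarrow> complex) set \<Rightarrow> (nat \<Rightarrow> complex) \<Rightarrow> (nat \<Rightarrow> complex)" where
  "cproj d W x = (THE w. w \<in> W \<and> (\<forall>u\<in>W. cinner d (\<lambda>i. x i - w i) u = 0))"

definition to_complex :: "(nat \<Rightarrow> real) \<Rightarrow> (nat \<Rightarrow> complex)" where
  "to_complex x = (\<lambda>i. complex_of_real (x i))"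

definition unit_sphere :: "nat \<Rightarrow> (nat \<Rightarrow> real) set" where
  "unit_sphere d = {x \<in> coord_space d. rnorm d x = 1}"

text \<open>The orthogonal group O(\<real>^d): linear maps of \<open>\<real>^d\<close> preserving the inner product
  (restricted to \<open>\<real>^d\<close>; in finite dimension these are automatically bijective).\<close>
definition orthogonal_map :: "nat \<Rightarrow> ((nat \<Rightarrow> real) \<Rightarrow> (nat \<Rightarrow> real)) \<Rightarrow> bool" where
  "orthogonal_map d g \<longleftrightarrow>
     (\<forall>x\<in>coord_space d. g x \<in> coord_space d)
   \<and> (\<forall>x\<in>coord_space d. \<forall>y\<in>coord_space d. \<forall>a b.
        g (\<lambda>i. a * x i + b * y i) = (\<lambda>i. a * g x i + b * g y i))
   \<and> (\<forall>x\<in>coord_space d. \<forall>y\<in>coord_space d. rinner d (g x) (g y) = rinner d x y)"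

definition transitive_set :: "nat \<Rightarrow> (nat \<Rightarrow> real) set \<Rightarrow> bool" where
  "transitive_set d X \<longleftrightarrow>
     (\<forall>x\<in>X. \<forall>x'\<in>X. \<exists>g. orthogonal_map d g \<and> g ` X = X \<and> g x = x')"

end

theory Submission
  imports Defs "HOL-Analysis.Analysis" "HOL-Combinatorics.Permutations"
begin

text \<open>
  Take for X the signed permutations of the unit vector u proportional to
  \<open>1 / sqrt (max (m + 1) k)\<close>, \<open>m < d\<close>; its normalising constant is of order
  \<open>sqrt (ln (2 * d / k))\<close>.  Let W be a complex subspace with orthonormal basis \<open>c\<^sub>j\<close> and put
  \<open>p\<^sub>i = (\<Sum>j<k. |c\<^sub>j(i)|\<^sup>2)\<close>, the squared length of the projection of the i-th coordinate vector.
  Then \<open>p\<^sub>i \<le> 1\<close> and \<open>\<Sum>p\<^sub>i = k\<close>, so the entry of rank m in decreasing order is at most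
  \<open>k / max (m + 1) k\<close>.  For a random choice of signs, the vector \<open>\<Sum>\<plusminus>c\<^sub>j / sqrt k\<close> is a unit vector
  of W, and by Khinchine's inequality its i-th entry has mean modulus at least
  \<open>5/9 * sqrt (p\<^sub>i / k)\<close>.  Pairing it with the element of X whose order is that of p and whose
  signs are favourable therefore gives on average a constant multiple of
  \<open>\<Sum>p\<^sub>i / k = 1\<close> over the normalising constant.  Real subspaces reduce to their complexifications.
\<close>

section \<open>Khinchine's inequality\<close>

text \<open>\<open>A\<close> is the set of indices that carry the sign plus. The subsets of
  \<open>{..<k}\<close> thus encode the \<open>2 ^ k\<close> sign patterns, and averaging over
  random signs is summation over \<open>Pow {..<k}\<close>.\<close>

definition signed_sum :: "nat \<Rightarrow> (nat \<Rightarrow> 'a::ab_group_add) \<Rightarrow> nat set \<Rightarrow> 'a" where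
  "signed_sum k b A = (\<Sum>j<k. if j \<in> A then b j else - b j)"

lemma signed_sum_Suc:
  assumes "A \<subseteq> {..<k}"
  shows "signed_sum (Suc k) b A = signed_sum k b A - b k"
    and "signed_sum (Suc k) b (insert k A) = signed_sum k b A + b k"
proof -
  have "k \<notin> A" using assms by auto
  then show "signed_sum (Suc k) b A = signed_sum k b A - b k"
    by (simp add: signed_sum_def)
  have "(\<Sum>j<k. if j \<in> insert k A then b j else - b j) = (\<Sum>j<k. if j \<in> A then b j else - b j)"
    by (rule sum.cong) auto
  then show "signed_sum (Suc k) b (insert k A) = signed_sum k b A + b k"
    by (simp add: signed_sum_def)
qed

text \<open>Splits the sign patterns by the last sign; the moment computations below are inductions
  along this split.\<close>

lemma sum_Pow_lessThan_Suc:
  "(\<Sum>A\<in>Pow {..<Suc k}. f A) = (\<Sum>A\<in>Pow {..<k}. f A + f (insert k A))"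
proof -
  have inj: "inj_on (insert k) (Pow {..<k})"
    by (auto simp: inj_on_def insert_eq_iff dest: in_mono)
  have "(\<Sum>A\<in>Pow {..<Suc k}. f A) = (\<Sum>A\<in>Pow {..<k}. f A) + (\<Sum>A\<in>insert k ` Pow {..<k}. f A)"
    unfolding lessThan_Suc Pow_insert by (rule sum.union_disjoint) auto
  also have "(\<Sum>A\<in>insert k ` Pow {..<k}. f A) = (\<Sum>A\<in>Pow {..<k}. f (insert k A))"
    by (simp add: sum.reindex[OF inj])
  finally show ?thesis by (simp add: sum.distrib)
qed

text \<open>By the parallelogram law the cross terms of the two choices for the last sign
  cancel.\<close>

lemma sum_norm_signed_sum_power2:
  fixes b :: "nat \<Rightarrow> 'a::real_inner"
  shows "(\<Sum>A\<in>Pow {..<k}. (norm (signed_sum k b A))\<^sup>2) = 2 ^ k * (\<Sum>j<k. (norm (b j))\<^sup>2)"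
proof (induction k)
  case 0
  then show ?case by (simp add: signed_sum_def)
next
  case (Suc k)
  have par: "(norm (x - y))\<^sup>2 + (norm (x + y))\<^sup>2 = 2 * (norm x)\<^sup>2 + 2 * (norm y)\<^sup>2" for x y :: 'a
    by (simp add: power2_norm_eq_inner algebra_simps inner_commute)
  have "(\<Sum>A\<in>Pow {..<Suc k}. (norm (signed_sum (Suc k) b A))\<^sup>2)
      = (\<Sum>A\<in>Pow {..<k}. 2 * (norm (signed_sum k b A))\<^sup>2 + 2 * (norm (b k))\<^sup>2)"
    unfolding sum_Pow_lessThan_Suc by (intro sum.cong refl) (simp add: signed_sum_Suc par)
  also have "\<dots> = 2 ^ Suc k * (\<Sum>j<Suc k. (norm (b j))\<^sup>2)"
    by (simp add: sum.distrib Suc card_Pow algebra_simps flip: sum_distrib_left)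
  finally show ?case .
qed

text \<open>The same induction with a fourth-power analogue of the parallelogram law; the surviving
  cross term is bounded by Cauchy-Schwarz and averaged by the second moment.\<close>

lemma sum_norm_signed_sum_power4_le:
  fixes b :: "nat \<Rightarrow> 'a::real_inner"
  shows "(\<Sum>A\<in>Pow {..<k}. (norm (signed_sum k b A)) ^ 4) \<le> 3 * 2 ^ k * (\<Sum>j<k. (norm (b j))\<^sup>2)\<^sup>2"
proof (induction k)
  case 0
  then show ?case by (simp add: signed_sum_def)
next
  case (Suc k)
  define s where "s = (\<Sum>j<k. (norm (b j))\<^sup>2)"
  have par: "(norm (x - y)) ^ 4 + (norm (x + y)) ^ 4
      \<le> 2 * (norm x) ^ 4 + 12 * (norm y)\<^sup>2 * (norm x)\<^sup>2 + 2 * (norm y) ^ 4" for x y :: 'a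
  proof -
    have four: "(norm z) ^ 4 = (inner z z)\<^sup>2" for z :: 'a
      using power_mult[of "norm z" 2 2] by (simp add: power2_norm_eq_inner)
    have "(norm (x - y)) ^ 4 + (norm (x + y)) ^ 4
        = 2 * (inner x x + inner y y)\<^sup>2 + 8 * (inner x y)\<^sup>2"
      by (simp add: four inner_commute[of y x] inner_diff_left inner_diff_right inner_add_left
          inner_add_right power2_eq_square algebra_simps)
    also have "\<dots> \<le> 2 * (inner x x + inner y y)\<^sup>2 + 8 * (inner x x * inner y y)"
      using Cauchy_Schwarz_ineq[of x y] by simp
    finally show ?thesis
      by (simp add: four power2_norm_eq_inner) (simp add: power2_eq_square algebra_simps)
  qed
  have "(\<Sum>A\<in>Pow {..<Suc k}. (norm (signed_sum (Suc k) b A)) ^ 4)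
      \<le> (\<Sum>A\<in>Pow {..<k}. 2 * (norm (signed_sum k b A)) ^ 4
          + 12 * (norm (b k))\<^sup>2 * (norm (signed_sum k b A))\<^sup>2 + 2 * (norm (b k)) ^ 4)"
    unfolding sum_Pow_lessThan_Suc
  proof (rule sum_mono)
    fix A assume "A \<in> Pow {..<k}"
    then show "(norm (signed_sum (Suc k) b A)) ^ 4 + (norm (signed_sum (Suc k) b (insert k A))) ^ 4
        \<le> 2 * (norm (signed_sum k b A)) ^ 4
          + 12 * (norm (b k))\<^sup>2 * (norm (signed_sum k b A))\<^sup>2 + 2 * (norm (b k)) ^ 4"
      using par[of "signed_sum k b A" "b k"] by (simp only: signed_sum_Suc Pow_iff)
  qed
  also have "\<dots> = 2 * (\<Sum>A\<in>Pow {..<k}. (norm (signed_sum k b A)) ^ 4)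
      + 12 * (norm (b k))\<^sup>2 * (2 ^ k * s) + 2 * 2 ^ k * (norm (b k)) ^ 4"
    by (simp add: sum.distrib card_Pow sum_norm_signed_sum_power2 s_def flip: sum_distrib_left)
  \<comment> \<open>The last coefficient is raised from 2 to 6 so that the three terms form a
    perfect square.\<close>
  also have "\<dots> \<le> 2 * (3 * 2 ^ k * s\<^sup>2) + 12 * (norm (b k))\<^sup>2 * (2 ^ k * s)
      + 6 * 2 ^ k * (norm (b k)) ^ 4"
    using Suc by (intro add_mono mult_left_mono mult_right_mono) (auto simp: s_def)
  also have "\<dots> = 3 * 2 ^ Suc k * (s + (norm (b k))\<^sup>2)\<^sup>2"
    using power_mult[of "norm (b k)" 2 2] by (simp add: power2_sum algebra_simps)
  finally show ?case by (simp add: s_def)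
qed

text \<open>A pointwise bound of \<open>t\<close> from below by a combination of its second and
  fourth powers is averaged over the signs. The constant is \<open>5 / 9 = 1 - 3 * (4 / 27)\<close>,
  where 3 comes from the fourth moment.\<close>

lemma khinchine_L1:
  fixes b :: "nat \<Rightarrow> 'a::real_inner"
  shows "5 / 9 * 2 ^ k * sqrt (\<Sum>j<k. (norm (b j))\<^sup>2) \<le> (\<Sum>A\<in>Pow {..<k}. norm (signed_sum k b A))"
proof (cases "(\<Sum>j<k. (norm (b j))\<^sup>2) = 0")
  case True
  then show ?thesis by (simp add: sum_nonneg)
next
  case False
  define s where "s = sqrt (\<Sum>j<k. (norm (b j))\<^sup>2)"
  have s0: "s > 0"
    using False by (simp add: s_def sum_nonneg order_less_le)
  have s2: "(\<Sum>j<k. (norm (b j))\<^sup>2) = s\<^sup>2"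
    by (simp add: s_def sum_nonneg)
  \<comment> \<open>The polynomial below touches \<open>t \<mapsto> t\<close> at \<open>3/2\<close>; it trades the first moment for the second and fourth.\<close>
  have pt: "t\<^sup>2 - 4 / 27 * t ^ 4 \<le> t" if "t \<ge> 0" for t :: real
  proof -
    have "0 \<le> t * (t - 3 / 2)\<^sup>2 * (t + 3)" using that by simp
    also have "\<dots> = 27 / 4 * (t - t\<^sup>2 + 4 / 27 * t ^ 4)"
      by (simp add: power2_eq_square power4_eq_xxxx field_simps)
    finally show ?thesis by simp
  qed
  \<comment> \<open>Rescaling by the root mean square \<open>s\<close> makes the bound
    homogeneous.\<close>
  have pts: "1 / s * t\<^sup>2 - 4 / (27 * s ^ 3) * t ^ 4 \<le> t" if "t \<ge> 0" for t
  proof -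
    have "s * ((t / s)\<^sup>2 - 4 / 27 * (t / s) ^ 4) \<le> s * (t / s)"
      using pt[of "t / s"] s0 that by (intro mult_left_mono) auto
    moreover have "s * ((t / s)\<^sup>2 - 4 / 27 * (t / s) ^ 4) = 1 / s * t\<^sup>2 - 4 / (27 * s ^ 3) * t ^ 4"
      using s0 by (simp add: field_simps power2_eq_square power3_eq_cube power4_eq_xxxx)
    ultimately show ?thesis using s0 by simp
  qed
  have "5 / 9 * 2 ^ k * s = 1 / s * (2 ^ k * s\<^sup>2) - 4 / (27 * s ^ 3) * (3 * 2 ^ k * (s\<^sup>2)\<^sup>2)"
    using s0 by (simp add: field_simps power2_eq_square power3_eq_cube)
  also have "\<dots> \<le> 1 / s * (\<Sum>A\<in>Pow {..<k}. (norm (signed_sum k b A))\<^sup>2)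
      - 4 / (27 * s ^ 3) * (\<Sum>A\<in>Pow {..<k}. (norm (signed_sum k b A)) ^ 4)"
    using sum_norm_signed_sum_power4_le[of k b] s0
    by (intro diff_mono mult_left_mono) (simp_all add: sum_norm_signed_sum_power2 s2)
  also have "\<dots> = (\<Sum>A\<in>Pow {..<k}. 1 / s * (norm (signed_sum k b A))\<^sup>2
      - 4 / (27 * s ^ 3) * (norm (signed_sum k b A)) ^ 4)"
    by (simp only: sum_subtractf sum_distrib_left)
  also have "\<dots> \<le> (\<Sum>A\<in>Pow {..<k}. norm (signed_sum k b A))"
    by (intro sum_mono pts) simp
  finally show ?thesis by (simp add: s_def)
qed

section \<open>Hermitian geometry of coordinate spaces\<close>

lemma cinner_diff_left: "cinner d (\<lambda>i. x i - y i) z = cinner d x z - cinner d y z"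
  by (simp add: cinner_def sum_subtractf algebra_simps)

lemma cinner_scale_left: "cinner d (\<lambda>i. a * x i) z = a * cinner d x z"
  by (simp add: cinner_def sum_distrib_left mult_ac)

lemma cinner_commute: "cinner d x y = cnj (cinner d y x)"
  by (simp add: cinner_def mult_ac)

lemma cinner_lincomb_left: "cinner d (lincomb k a b) z = (\<Sum>j<k. a j * cinner d (b j) z)"
proof -
  have "cinner d (lincomb k a b) z = (\<Sum>i<d. \<Sum>j<k. a j * b j i * cnj (z i))"
    by (simp add: cinner_def lincomb_def sum_distrib_right)
  also have "\<dots> = (\<Sum>j<k. \<Sum>i<d. a j * b j i * cnj (z i))"
    by (rule sum.swap)
  finally show ?thesis
    by (simp add: cinner_def sum_distrib_left mult_ac)
qed

lemma cinner_lincomb_right: "cinner d z (lincomb k a b) = (\<Sum>j<k. cnj (a j) * cinner d z (b j))"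
  by (subst cinner_commute) (simp add: cinner_lincomb_left cinner_commute[of d z])

lemma cinner_self: "cinner d x x = complex_of_real ((cnorm d x)\<^sup>2)"
  by (simp add: cinner_def cnorm_def sum_nonneg complex_norm_square del: of_real_power)

lemma cnorm_eq_0_coord_space:
  assumes "cnorm d x = 0" "x \<in> coord_space d"
  shows "x = (\<lambda>_. 0)"
proof
  fix i
  have "\<forall>i<d. x i = 0"
    using assms(1) by (simp add: cnorm_def sum_nonneg_eq_0_iff)
  then show "x i = 0"
    using assms(2) by (cases "i < d") (auto simp: coord_space_def)
qed

lemma lincomb_coord_space:
  "\<forall>j<k. b j \<in> coord_space d \<Longrightarrow> lincomb k a b \<in> coord_space d"
  by (simp add: lincomb_def coord_space_def)

lemma lincomb_diff: "(\<lambda>i. lincomb k a b i - lincomb k a' b i) = lincomb k (\<lambda>j. a j - a' j) b"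
  by (simp add: lincomb_def sum_subtractf left_diff_distrib)

text \<open>\<open>cinner d\<close> sees only the coordinates below \<open>d\<close>, so vanishing
  of the others is demanded separately.\<close>

definition orthonormal :: "nat \<Rightarrow> nat \<Rightarrow> (nat \<Rightarrow> nat \<Rightarrow> complex) \<Rightarrow> bool" where
  "orthonormal d k c \<longleftrightarrow> (\<forall>j<k. c j \<in> coord_space d) \<and>
     (\<forall>i<k. \<forall>j<k. cinner d (c i) (c j) = (if i = j then 1 else 0))"

lemma cinner_lincomb_orthonormal:
  assumes "orthonormal d k c" "l < k"
  shows "cinner d (lincomb k a c) (c l) = a l"
proof -
  have "cinner d (lincomb k a c) (c l) = (\<Sum>j<k. if j = l then a j else 0)"
    unfolding cinner_lincomb_left using assms
    by (intro sum.cong refl) (auto simp: orthonormal_def)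
  then show ?thesis using assms(2) by simp
qed

lemma cnorm_lincomb_orthonormal:
  assumes "orthonormal d k c"
  shows "(cnorm d (lincomb k a c))\<^sup>2 = (\<Sum>j<k. (cmod (a j))\<^sup>2)"
proof -
  have "complex_of_real ((cnorm d (lincomb k a c))\<^sup>2) = (\<Sum>j<k. cnj (a j) * a j)"
    unfolding cinner_self[symmetric] cinner_lincomb_right
    using assms by (intro sum.cong refl) (simp add: cinner_lincomb_orthonormal)
  also have "\<dots> = complex_of_real (\<Sum>j<k. (cmod (a j))\<^sup>2)"
    by (simp add: complex_norm_square mult.commute del: of_real_power)
  finally show ?thesis by (simp only: of_real_eq_iff)
qed

text \<open>Induction on \<open>k\<close>: what is left of the last vector after removing its
  projection onto the earlier span is normalised. Equality of the spans is carried along because it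
  expresses that projection through the old basis.\<close>

lemma gram_schmidt:
  assumes "\<forall>j<k. b j \<in> coord_space d"
    and "\<forall>a. lincomb k a b = (\<lambda>_. 0) \<longrightarrow> (\<forall>j<k. a j = 0)"
  shows "\<exists>c. orthonormal d k c \<and> range (\<lambda>a. lincomb k a c) = range (\<lambda>a. lincomb k a b)"
  using assms
proof (induction k)
  case 0
  then show ?case by (auto simp: orthonormal_def lincomb_def)
next
  case (Suc k)
  have upd: "lincomb (Suc k) a (f(k := v)) = (\<lambda>i. lincomb k a f i + a k * v i)"
    for a v and f :: "nat \<Rightarrow> nat \<Rightarrow> complex"
    by (auto simp: lincomb_def)
  have updc: "lincomb (Suc k) (a(k := t)) f = (\<lambda>i. lincomb k a f i + t * f k i)"
    for a t and f :: "nat \<Rightarrow> nat \<Rightarrow> complex"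
    by (auto simp: lincomb_def)
  have step: "lincomb (Suc k) a f = (\<lambda>i. lincomb k a f i + a k * f k i)"
    for a and f :: "nat \<Rightarrow> nat \<Rightarrow> complex"
    by (auto simp: lincomb_def)
  have "\<forall>a. lincomb k a b = (\<lambda>_. 0) \<longrightarrow> (\<forall>j<k. a j = 0)"
  proof (intro allI impI)
    fix a j assume "lincomb k a b = (\<lambda>_. 0)" "j < k"
    then show "a j = 0"
      using Suc.prems(2)[rule_format, of "a(k := 0)" j] by (auto simp: updc)
  qed
  then obtain c where c: "orthonormal d k c"
    and span: "range (\<lambda>a. lincomb k a c) = range (\<lambda>a. lincomb k a b)"
    using Suc.IH Suc.prems(1) by auto
  define p where "p = lincomb k (\<lambda>j. cinner d (b k) (c j)) c"
  define v where "v = (\<lambda>i. b k i - p i)"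
  have pcs: "p \<in> coord_space d"
    unfolding p_def using c by (intro lincomb_coord_space) (auto simp: orthonormal_def)
  have vcs: "v \<in> coord_space d"
    using pcs Suc.prems(1) by (auto simp: v_def coord_space_def)
  obtain a0 where a0: "p = lincomb k a0 b"
    using span unfolding p_def by blast
  have vorth: "cinner d v (c j) = 0" if "j < k" for j
    using that c unfolding v_def p_def
    by (simp add: cinner_diff_left cinner_lincomb_orthonormal)
  define n where "n = cnorm d v"
  \<comment> \<open>If the remainder vanished, \<open>b k\<close> would equal \<open>p\<close>, a
    combination of the earlier vectors, giving a vanishing combination with coefficient 1 at
    \<open>k\<close>.\<close>
  have n0: "n \<noteq> 0"
  proof
    assume "n = 0"
    then have "v = (\<lambda>_. 0)" using cnorm_eq_0_coord_space[OF _ vcs] by (simp add: n_def)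
    then have "lincomb (Suc k) ((\<lambda>j. - a0 j)(k := 1)) b = (\<lambda>_. 0)"
      unfolding updc by (auto simp: v_def a0 lincomb_def sum_negf fun_eq_iff)
    then have "((\<lambda>j. - a0 j)(k := (1::complex))) k = 0"
      using Suc.prems(2) by blast
    then show False by simp
  qed
  define e where "e = (\<lambda>i. complex_of_real (1 / n) * v i)"
  define c' where "c' = c(k := e)"
  have bk: "b k = (\<lambda>i. p i + complex_of_real n * e i)"
    using n0 by (auto simp: e_def v_def)
  have ecj: "cinner d e (c j) = 0" if "j < k" for j
    unfolding e_def cinner_scale_left using vorth[OF that] by simp
  have cje: "cinner d (c j) e = 0" if "j < k" for j
    by (subst cinner_commute) (simp add: ecj that)
  have "cinner d e e = complex_of_real (1 / n) * cnj (complex_of_real (1 / n) * cinner d v v)"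
    unfolding e_def cinner_scale_left
    by (subst cinner_commute) (simp only: cinner_scale_left)
  then have ee: "cinner d e e = 1"
    using n0 by (simp add: cinner_self n_def[symmetric] power2_eq_square)
  have "e \<in> coord_space d" using vcs by (auto simp: e_def coord_space_def)
  then have "orthonormal d (Suc k) c'"
    using c ecj cje ee by (auto simp: orthonormal_def c'_def less_Suc_eq)
  moreover have "range (\<lambda>a. lincomb (Suc k) a c') = range (\<lambda>a. lincomb (Suc k) a b)"
  proof (intro equalityI subsetI; elim rangeE)
    fix x a assume x: "x = lincomb (Suc k) a c'"
    obtain a1 where a1: "lincomb k a c = lincomb k a1 b" using span by blast
    \<comment> \<open>Here \<open>e\<close> is \<open>(b k - p) / n\<close>, and \<open>p\<close>
      has the coefficients \<open>a0\<close> in the old basis.\<close>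
    have "x = lincomb (Suc k) ((\<lambda>j. a1 j - a k / n * a0 j)(k := a k / n)) b"
      unfolding x c'_def upd updc a1 lincomb_diff[symmetric]
      using n0 by (auto simp: e_def v_def a0 lincomb_def sum_subtractf sum_distrib_left field_simps)
    then show "x \<in> range (\<lambda>a. lincomb (Suc k) a b)" by blast
  next
    fix x a assume x: "x = lincomb (Suc k) a b"
    have "lincomb k a b \<in> range (\<lambda>a. lincomb k a c)" unfolding span by blast
    then obtain a1 where a1: "lincomb k a b = lincomb k a1 c" by blast
    \<comment> \<open>Conversely \<open>b k\<close> is \<open>p + n * e\<close>, and
      \<open>p\<close> has the coefficients \<open>cinner d (b k) (c j)\<close> in the new
      basis.\<close>
    let ?a = "\<lambda>j. a1 j + a k * cinner d (b k) (c j)"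
    have "x = lincomb (Suc k) (?a(k := a k * n)) c'"
    proof
      fix i
      have "lincomb k ?a c i = lincomb k a1 c i + a k * p i"
        by (simp add: lincomb_def p_def sum.distrib sum_distrib_left distrib_right mult.assoc)
      moreover have "lincomb (Suc k) (?a(k := a k * n)) c' i = lincomb k ?a c i + a k * n * e i"
        by (simp add: c'_def lincomb_def)
      moreover have "x i = lincomb k a1 c i + a k * (p i + n * e i)"
        unfolding x step a1 using fun_cong[OF bk, of i] by simp
      ultimately show "x i = lincomb (Suc k) (?a(k := a k * n)) c' i"
        by (simp add: algebra_simps)
    qed
    then show "x \<in> range (\<lambda>a. lincomb (Suc k) a c')" by blast
  qed
  ultimately show ?case by blast
qed

lemma ksubspace_orthonormal_basis:
  fixes W :: "(nat \<Rightarrow> complex) set"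
  assumes "ksubspace d k W"
  obtains c where "orthonormal d k c" "W = range (\<lambda>a. lincomb k a c)"
proof -
  obtain b where b: "\<forall>j<k. b j \<in> coord_space d"
      "\<forall>a. lincomb k a b = (\<lambda>_. 0) \<longrightarrow> (\<forall>j<k. a j = 0)"
    and W: "W = range (\<lambda>a. lincomb k a b)"
    using assms unfolding ksubspace_def full_SetCompr_eq by blast
  show thesis using gram_schmidt[OF b] that W by metis
qed

section \<open>Orthogonal projection in orthonormal coordinates\<close>

text \<open>The difference of two candidates lies in \<open>W\<close> and is also a difference of
  two residuals orthogonal to \<open>W\<close>, hence it is orthogonal to itself. This resolves the
  definite description in \<open>cproj\<close>.\<close>

lemma cproj_unique:
  assumes "ksubspace d k W" "w \<in> W" "\<forall>u\<in>W. cinner d (\<lambda>i. x i - w i) u = 0"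
  shows "cproj d W x = w"
  unfolding cproj_def
proof (rule the_equality)
  show "w \<in> W \<and> (\<forall>u\<in>W. cinner d (\<lambda>i. x i - w i) u = 0)" using assms by blast
next
  fix w' assume w': "w' \<in> W \<and> (\<forall>u\<in>W. cinner d (\<lambda>i. x i - w' i) u = 0)"
  obtain b where b: "\<forall>j<k. b j \<in> coord_space d" "W = range (\<lambda>a. lincomb k a b)"
    using assms(1) unfolding ksubspace_def full_SetCompr_eq by blast
  define z where "z = (\<lambda>i. w' i - w i)"
  have zW: "z \<in> W"
    using assms(2) w' unfolding b(2) z_def by (auto simp: lincomb_diff)
  have "cinner d z z = cinner d (\<lambda>i. x i - w i) z - cinner d (\<lambda>i. x i - w' i) z"
    unfolding cinner_diff_left[symmetric] by (simp add: z_def)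
  also have "\<dots> = 0" using zW assms(3) w' by simp
  finally have "cnorm d z = 0" by (simp add: cinner_self)
  moreover have "z \<in> coord_space d" using zW b lincomb_coord_space by auto
  ultimately have "z = (\<lambda>_. 0)" by (rule cnorm_eq_0_coord_space)
  then show "w' = w" by (auto simp: z_def fun_eq_iff)
qed

lemma orthonormal_independent:
  assumes "orthonormal d k c" "lincomb k a c = (\<lambda>_. 0)" "j < k"
  shows "a j = 0"
  using cinner_lincomb_orthonormal[OF assms(1,3), of a] assms(2) by (simp add: cinner_def)

lemma orthonormal_ksubspace:
  assumes "orthonormal d k c"
  shows "ksubspace d k (range (\<lambda>a. lincomb k a c))"
  unfolding ksubspace_def full_SetCompr_eq
  using assms orthonormal_independent[OF assms] by (auto simp: orthonormal_def)

lemma cproj_orthonormal: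
  assumes "orthonormal d k c"
  shows "cproj d (range (\<lambda>a. lincomb k a c)) x = lincomb k (\<lambda>j. cinner d x (c j)) c"
proof (rule cproj_unique[OF orthonormal_ksubspace[OF assms]])
  show "\<forall>u\<in>range (\<lambda>a. lincomb k a c).
      cinner d (\<lambda>i. x i - lincomb k (\<lambda>j. cinner d x (c j)) c i) u = 0"
    by (auto simp: cinner_lincomb_right cinner_diff_left cinner_lincomb_orthonormal[OF assms])
qed simp

text \<open>Up to conjugation the sum is the inner product of \<open>x\<close> with a vector of the
  subspace whose coefficients are all 1 or -1. That vector has norm \<open>sqrt k\<close>, and only
  the projection of \<open>x\<close> contributes to the product.\<close>

lemma cmod_sum_signed_sum_le:
  assumes c: "orthonormal d k c"
  shows "cmod (\<Sum>i<d. complex_of_real (x i) * signed_sum k (\<lambda>j. c j i) A)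
    \<le> sqrt k * cnorm d (cproj d (range (\<lambda>a. lincomb k a c)) (to_complex x))"
proof -
  define e where "e j = (if j \<in> A then 1 else - 1 :: complex)" for j
  define f where "f j = cinner d (to_complex x) (c j)" for j
  have ss: "signed_sum k (\<lambda>j. c j i) A = lincomb k e c i" for i
    unfolding signed_sum_def lincomb_def by (intro sum.cong) (auto simp: e_def)
  have "(\<Sum>i<d. complex_of_real (x i) * lincomb k e c i) = cnj (cinner d (to_complex x) (lincomb k e c))"
    by (simp add: cinner_def to_complex_def)
  then have "cmod (\<Sum>i<d. complex_of_real (x i) * signed_sum k (\<lambda>j. c j i) A)
      = cmod (\<Sum>j<k. cnj (e j) * f j)"
    unfolding ss f_def cinner_lincomb_right[symmetric] by simp
  also have "\<dots> \<le> (\<Sum>j<k. cmod (cnj (e j) * f j))" by (rule norm_sum)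
  also have "\<dots> = (\<Sum>j<k. cmod (f j))"
    by (intro sum.cong) (auto simp: norm_mult e_def)
  \<comment> \<open>Cauchy-Schwarz against the constant vector 1.\<close>
  also have "\<dots> \<le> sqrt ((\<Sum>j<k. (cmod (f j))\<^sup>2) * k)"
    using sum_squared_le_sum_of_squares[of "\<lambda>j. cmod (f j)" "{..<k}"]
    by (intro real_le_rsqrt) simp
  also have "\<dots> = sqrt k * cnorm d (lincomb k f c)"
  proof -
    have "cnorm d (lincomb k f c) \<ge> 0" by (simp add: cnorm_def sum_nonneg)
    then show ?thesis
      by (simp add: cnorm_lincomb_orthonormal[OF c, symmetric] real_sqrt_mult)
  qed
  finally show ?thesis
    unfolding cproj_orthonormal[OF c] f_def .
qed

text \<open>The double sum is the trace of the orthogonal projection onto the span; each basis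
  vector contributes 1.\<close>

lemma sum_orthonormal_coordinates:
  assumes "orthonormal d k c"
  shows "(\<Sum>i<d. \<Sum>j<k. (cmod (c j i))\<^sup>2) = k"
proof -
  have "(\<Sum>i<d. (cmod (c j i))\<^sup>2) = 1" if "j < k" for j
  proof -
    have "complex_of_real (\<Sum>i<d. (cmod (c j i))\<^sup>2) = cinner d (c j) (c j)"
      by (simp add: cinner_self cnorm_def sum_nonneg)
    also have "\<dots> = 1" using assms that by (simp add: orthonormal_def)
    finally show ?thesis by (simp only: of_real_eq_1_iff)
  qed
  then show ?thesis by (subst sum.swap) simp
qed

lemma orthonormal_coordinate_le_1:
  assumes "orthonormal d k c" "i < d"
  shows "(\<Sum>j<k. (cmod (c j i))\<^sup>2) \<le> 1"
proof -
  define p where "p = (\<Sum>j<k. (cmod (c j i))\<^sup>2)"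
  \<comment> \<open>v is the projection of the i-th coordinate vector: \<open>p = v\<^sub>i\<close> and \<open>p = \<parallel>v\<parallel>\<^sup>2 \<ge> |v\<^sub>i|\<^sup>2\<close>.\<close>
  define v where "v = lincomb k (\<lambda>j. cnj (c j i)) c"
  have "v i = complex_of_real p"
    by (simp add: v_def lincomb_def p_def complex_norm_square mult.commute del: of_real_power)
  then have "p\<^sup>2 = (cmod (v i))\<^sup>2" by simp
  also have "\<dots> \<le> (\<Sum>i<d. (cmod (v i))\<^sup>2)"
    using assms(2) by (intro member_le_sum) auto
  also have "\<dots> = (cnorm d v)\<^sup>2" by (simp add: cnorm_def sum_nonneg)
  also have "\<dots> = p"
    using cnorm_lincomb_orthonormal[OF assms(1)] by (simp add: v_def p_def)
  finally have "p * p \<le> p * 1" by (simp add: power2_eq_square)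
  moreover have "p \<ge> 0" by (simp add: p_def sum_nonneg)
  ultimately show ?thesis
    unfolding p_def[symmetric] by (cases "p = 0") auto
qed

section \<open>Orbits of signed permutations\<close>

text \<open>The orbit of \<open>u\<close> under the hyperoctahedral group. The signs are functions
  on all naturals, and the value 0 from \<open>d\<close> on puts the vectors into
  \<open>coord_space d\<close>.\<close>

definition signed_perms :: "nat \<Rightarrow> (nat \<Rightarrow> real) \<Rightarrow> (nat \<Rightarrow> real) set" where
  "signed_perms d u = {\<lambda>i. if i < d then e i * u (s i) else 0 | e s.
     (\<forall>i. e i \<in> {1, - 1}) \<and> s permutes {..<d}}"

lemma finite_signed_perms: "finite (signed_perms d u)"
proof (rule finite_subset)
  let ?V = "u ` {..<d} \<union> (\<lambda>m. - u m) ` {..<d}"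
  show "finite {f. \<forall>i. (i \<in> {..<d} \<longrightarrow> f i \<in> ?V) \<and> (i \<notin> {..<d} \<longrightarrow> f i = 0)}"
    by (intro finite_set_of_finite_funs) auto
  show "signed_perms d u
      \<subseteq> {f. \<forall>i. (i \<in> {..<d} \<longrightarrow> f i \<in> ?V) \<and> (i \<notin> {..<d} \<longrightarrow> f i = 0)}"
  proof
    fix x assume "x \<in> signed_perms d u"
    then obtain e s where x: "x = (\<lambda>i. if i < d then e i * u (s i) else 0)"
      and e: "\<forall>i. e i \<in> {1, - 1}" and s: "s permutes {..<d}"
      unfolding signed_perms_def by blast
    have "x i \<in> ?V" if "i < d" for i
    proof -
      have "s i \<in> {..<d}" using that permutes_in_image[OF s, of i] by simp
      moreover have "e i = 1 \<or> e i = - 1" using e by blast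
      ultimately show ?thesis using that by (auto simp: x)
    qed
    then show "x \<in> {f. \<forall>i. (i \<in> {..<d} \<longrightarrow> f i \<in> ?V) \<and> (i \<notin> {..<d} \<longrightarrow> f i = 0)}"
      by (simp add: x)
  qed
qed

lemma signed_perms_nonempty: "signed_perms d u \<noteq> {}"
proof -
  have "(\<lambda>i. if i < d then 1 * u (id i) else 0) \<in> signed_perms d u"
    unfolding signed_perms_def
    by (intro CollectI exI[of _ "\<lambda>_. 1"] exI[of _ id]) (simp add: permutes_id)
  then show ?thesis by blast
qed

lemma rinner_signed_perm:
  assumes "\<forall>i. e i \<in> {1, - 1 :: real}" "s permutes {..<d}"
  shows "rinner d (\<lambda>i. if i < d then e i * x (s i) else 0) (\<lambda>i. if i < d then e i * y (s i) else 0)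
    = rinner d x y"
proof -
  have ee: "e i * e i = 1" for i using assms(1) by (metis insertE mult_1 mult_minus_left minus_minus singletonD)
  have "rinner d (\<lambda>i. if i < d then e i * x (s i) else 0) (\<lambda>i. if i < d then e i * y (s i) else 0)
      = (\<Sum>i<d. (e i * e i) * (x (s i) * y (s i)))"
    unfolding rinner_def by (intro sum.cong) (auto simp: mult_ac)
  also have "\<dots> = (\<Sum>i<d. x (s i) * y (s i))" by (simp add: ee)
  also have "\<dots> = rinner d x y"
    unfolding rinner_def using sum.permute[OF assms(2), of "\<lambda>i. x i * y i"] by (simp add: o_def)
  finally show ?thesis .
qed

lemma signed_perms_unit_sphere:
  assumes "(\<Sum>i<d. (u i)\<^sup>2) = 1"
  shows "signed_perms d u \<subseteq> unit_sphere d"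
proof
  fix x assume "x \<in> signed_perms d u"
  then obtain e s where x: "x = (\<lambda>i. if i < d then e i * u (s i) else 0)"
    and e: "\<forall>i. e i \<in> {1, - 1}" and s: "s permutes {..<d}"
    unfolding signed_perms_def by blast
  have "rinner d x x = 1"
    unfolding x rinner_signed_perm[OF e s] using assms by (simp add: rinner_def power2_eq_square)
  then show "x \<in> unit_sphere d"
    by (simp add: unit_sphere_def rnorm_def coord_space_def x)
qed

lemma orthogonal_signed_perm:
  assumes "\<forall>i. e i \<in> {1, - 1 :: real}" "s permutes {..<d}"
  shows "orthogonal_map d (\<lambda>x i. if i < d then e i * x (s i) else 0)"
  unfolding orthogonal_map_def
  by (auto simp: rinner_signed_perm[OF assms] coord_space_def algebra_simps)

lemma transitive_signed_perms: "transitive_set d (signed_perms d u)"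
  unfolding transitive_set_def
proof (intro ballI)
  fix x x' assume "x \<in> signed_perms d u" "x' \<in> signed_perms d u"
  then obtain e s e' s' where
    x: "x = (\<lambda>i. if i < d then e i * u (s i) else 0)" and
    e: "\<forall>i. e i \<in> {1, - 1}" and s: "s permutes {..<d}" and
    x': "x' = (\<lambda>i. if i < d then e' i * u (s' i) else 0)" and
    e': "\<forall>i. e' i \<in> {1, - 1}" and s': "s' permutes {..<d}"
    unfolding signed_perms_def by blast
  \<comment> \<open>With these choices \<open>s (r i) = s' i\<close> and the sign
    \<open>e (r i)\<close> occurs squared, so only \<open>e' i * u (s' i)\<close> remains of
    \<open>g x i\<close>.\<close>
  define r where "r = inv s \<circ> s'"
  define t where "t i = e' i * e (r i)" for i
  define g where "g = (\<lambda>(y::nat \<Rightarrow> real) i. if i < d then t i * y (r i) else 0)"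
  have r: "r permutes {..<d}"
    unfolding r_def using s s' by (intro permutes_compose permutes_inv)
  have rd: "r i < d" if "i < d" for i
    using permutes_in_image[OF r, of i] that by simp
  have prod: "a * b \<in> {1, - 1}" if "a \<in> {1, - 1}" "b \<in> {1, - 1}" for a b :: real
    using that by auto
  have t: "\<forall>i. t i \<in> {1, - 1}" unfolding t_def using e e' prod by blast
  have "g x = x'"
  proof
    fix i
    have "e (r i) * e (r i) = 1" using e by (metis insertE mult_1 mult_minus_left minus_minus singletonD)
    moreover have "s (r i) = s' i" using s by (simp add: r_def permutes_inverses)
    ultimately show "g x i = x' i" by (simp add: g_def x x' rd t_def)
  qed
  \<comment> \<open>On a finite set, an injective map into the set is onto.\<close>
  moreover have "g ` signed_perms d u = signed_perms d u"
  proof (rule endo_inj_surj[OF finite_signed_perms])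
    show "g ` signed_perms d u \<subseteq> signed_perms d u"
    proof
      fix z assume "z \<in> g ` signed_perms d u"
      then obtain f q where z: "z = g (\<lambda>i. if i < d then f i * u (q i) else 0)"
        and f: "\<forall>i. f i \<in> {1, - 1}" and q: "q permutes {..<d}"
        unfolding signed_perms_def by blast
      have "z = (\<lambda>i. if i < d then (t i * f (r i)) * u ((q \<circ> r) i) else 0)"
        using rd by (auto simp: z g_def fun_eq_iff)
      moreover have "\<forall>i. t i * f (r i) \<in> {1, - 1}" using t f prod by blast
      moreover have "q \<circ> r permutes {..<d}" using q r by (rule permutes_compose[rotated])
      ultimately show "z \<in> signed_perms d u"
        unfolding signed_perms_def by (intro CollectI exI[of _ "\<lambda>i. t i * f (r i)"] exI[of _ "q \<circ> r"]) auto
    qed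
    show "inj_on g (signed_perms d u)"
    proof (intro inj_onI ext)
      fix y y' i assume y: "y \<in> signed_perms d u" "y' \<in> signed_perms d u" and eq: "g y = g y'"
      show "y i = y' i"
      proof (cases "i < d")
        case True
        have "inv r i < d" using permutes_in_image[OF permutes_inv[OF r], of i] True by simp
        moreover have "t (inv r i) \<noteq> 0" using t by (metis insertE singletonD zero_neq_one zero_neq_neg_one)
        ultimately show ?thesis
          using fun_cong[OF eq, of "inv r i"] by (simp add: g_def permutes_inverses[OF r])
      next
        case False
        then show ?thesis using y by (auto simp: signed_perms_def)
      qed
    qed
  qed
  ultimately show "\<exists>g. orthogonal_map d g \<and> g ` signed_perms d u = signed_perms d u \<and> g x = x'"
    using orthogonal_signed_perm[OF t r] unfolding g_def by blast
qed

section \<open>Ranks, signs and the lower bound for complex subspaces\<close>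

text \<open>\<open>s i\<close> is the rank of \<open>p i\<close> in decreasing order, counted from
  0. The entry of rank \<open>m\<close> is dominated by each of the first \<open>m + 1\<close>
  entries, and these sum to at most the total.\<close>

lemma exists_rank_permutation:
  fixes p :: "nat \<Rightarrow> real"
  assumes "\<And>i. p i \<ge> 0"
  obtains s where "s permutes {..<d}" "\<And>i. i < d \<Longrightarrow> (real (s i) + 1) * p i \<le> (\<Sum>j<d. p j)"
proof -
  define xs where "xs = sort_key (\<lambda>i. - p i) [0..<d]"
  have xs: "length xs = d" "set xs = {..<d}" "distinct xs" "sorted (map (\<lambda>i. - p i) xs)"
    by (auto simp: xs_def)
  \<comment> \<open>\<open>t\<close> takes a rank to its index, so \<open>inv t\<close> is the
    permutation sought; \<open>permutes\<close> requires the identity from \<open>d\<close>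
    on.\<close>
  define t where "t m = (if m < d then xs ! m else m)" for m
  have "bij_betw ((!) xs) {..<d} {..<d}"
    using xs by (intro bij_betw_nth) auto
  then have "bij_betw t {..<d} {..<d}"
    by (rule bij_betw_cong[THEN iffD1, rotated]) (simp add: t_def)
  then have t: "t permutes {..<d}"
    by (rule bij_imp_permutes) (simp add: t_def)
  have anti: "p (t n) \<le> p (t m)" if "m \<le> n" "n < d" for m n
    using sorted_nth_mono[OF xs(4), of m n] that xs(1) by (simp add: t_def)
  show thesis
  proof
    show "inv t permutes {..<d}" using t by (rule permutes_inv)
    fix i assume "i < d"
    then have m: "inv t i < d"
      using permutes_in_image[OF permutes_inv[OF t], of i] by simp
    have "(real (inv t i) + 1) * p i = (\<Sum>m\<le>inv t i. p (t (inv t i)))"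
      by (simp add: permutes_inverses[OF t] algebra_simps)
    also have "\<dots> \<le> (\<Sum>m\<le>inv t i. p (t m))"
      using m by (intro sum_mono anti) auto
    also have "\<dots> \<le> (\<Sum>m<d. p (t m))"
      using m assms by (intro sum_mono2) auto
    also have "\<dots> = (\<Sum>j<d. p j)"
      using sum.permute[OF t, of p] by (simp add: o_def)
    finally show "(real (inv t i) + 1) * p i \<le> (\<Sum>j<d. p j)" .
  qed
qed

text \<open>Real signs cannot align complex numbers, so the real and the imaginary parts are aligned
  separately; each costs one \<open>M\<close>.\<close>

lemma sum_mult_cmod_le_signed:
  fixes z :: "nat \<Rightarrow> complex" and y :: "nat \<Rightarrow> real"
  assumes "\<And>i. i < d \<Longrightarrow> y i \<ge> 0"
    and M: "\<And>e. \<forall>i. e i \<in> {1, - 1} \<Longrightarrow> cmod (\<Sum>i<d. complex_of_real (e i * y i) * z i) \<le> M"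
  shows "(\<Sum>i<d. y i * cmod (z i)) \<le> 2 * M"
proof -
  define e where "e i = (if Re (z i) \<ge> 0 then 1 else - 1 :: real)" for i
  define f where "f i = (if Im (z i) \<ge> 0 then 1 else - 1 :: real)" for i
  have "(\<Sum>i<d. y i * cmod (z i)) \<le> (\<Sum>i<d. y i * (\<bar>Re (z i)\<bar> + \<bar>Im (z i)\<bar>))"
    using assms(1) by (intro sum_mono mult_left_mono cmod_le) auto
  also have "\<dots> = (\<Sum>i<d. e i * y i * Re (z i)) + (\<Sum>i<d. f i * y i * Im (z i))"
    unfolding sum.distrib[symmetric] by (intro sum.cong) (auto simp: e_def f_def algebra_simps)
  also have "\<dots> = Re (\<Sum>i<d. complex_of_real (e i * y i) * z i)
      + Im (\<Sum>i<d. complex_of_real (f i * y i) * z i)"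
    by simp
  also have "\<dots> \<le> M + M"
  proof (rule add_mono)
    show "Re (\<Sum>i<d. complex_of_real (e i * y i) * z i) \<le> M"
      using complex_Re_le_cmod M[of e] by (rule order_trans) (simp add: e_def)
    show "Im (\<Sum>i<d. complex_of_real (f i * y i) * z i) \<le> M"
      using abs_Im_le_cmod M[of f] by (rule order_trans[OF abs_ge_self order_trans]) (simp add: f_def)
  qed
  finally show ?thesis by simp
qed

text \<open>The constant is half of Khinchine's \<open>5 / 9\<close>, the half coming from the
  separate alignment of real and imaginary parts.\<close>

lemma signed_perms_width_complex:
  fixes W :: "(nat \<Rightarrow> complex) set"
  assumes k: "1 \<le> k" and W: "ksubspace d k W"
    and u: "\<And>m. m < d \<Longrightarrow> u m \<ge> 0"
    and r: "\<And>m. m < d \<Longrightarrow> r \<le> u m * sqrt (max (real m + 1) (real k))"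
    and M: "\<And>x. x \<in> signed_perms d u \<Longrightarrow> cnorm d (cproj d W (to_complex x)) \<le> M"
  shows "5 / 18 * r \<le> M"
proof -
  obtain c where c: "orthonormal d k c" and Wc: "W = range (\<lambda>a. lincomb k a c)"
    using W by (rule ksubspace_orthonormal_basis)
  define p where "p i = (\<Sum>j<k. (cmod (c j i))\<^sup>2)" for i
  have p0: "p i \<ge> 0" for i by (simp add: p_def sum_nonneg)
  obtain s where s: "s permutes {..<d}" and "\<And>i. i < d \<Longrightarrow> (real (s i) + 1) * p i \<le> (\<Sum>j<d. p j)"
    using exists_rank_permutation[of p d] p0 by blast
  then have rank: "(real (s i) + 1) * p i \<le> k" if "i < d" for i
    using that sum_orthonormal_coordinates[OF c] by (simp add: p_def)
  have sd: "s i < d" if "i < d" for i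
    using permutes_in_image[OF s, of i] that by simp
  define y where "y i = u (s i)" for i
  have y0: "y i \<ge> 0" if "i < d" for i using that sd u by (simp add: y_def)
  let ?S = "\<lambda>A i. signed_sum k (\<lambda>j. c j i) A"
  \<comment> \<open>For a fixed pattern \<open>A\<close>, every choice of signs on the rank-ordered
    profile \<open>y\<close> gives an element of the orbit, to which \<open>M\<close>
    applies.\<close>
  have M': "(\<Sum>i<d. y i * cmod (?S A i)) \<le> 2 * (sqrt k * M)" for A
  proof (rule sum_mult_cmod_le_signed)
    fix e :: "nat \<Rightarrow> real" assume e: "\<forall>i. e i \<in> {1, - 1}"
    define x where "x = (\<lambda>i. if i < d then e i * u (s i) else 0)"
    have xX: "x \<in> signed_perms d u" unfolding signed_perms_def x_def using e s by blast
    have "cmod (\<Sum>i<d. complex_of_real (e i * y i) * ?S A i)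
        = cmod (\<Sum>i<d. complex_of_real (x i) * ?S A i)"
      by (intro arg_cong[where f = cmod] sum.cong) (auto simp: x_def y_def)
    also have "\<dots> \<le> sqrt k * cnorm d (cproj d W (to_complex x))"
      unfolding Wc by (rule cmod_sum_signed_sum_le[OF c])
    also have "\<dots> \<le> sqrt k * M"
      using M[OF xX] by (intro mult_left_mono) auto
    finally show "cmod (\<Sum>i<d. complex_of_real (e i * y i) * ?S A i) \<le> sqrt k * M" .
  qed (use y0 in auto)
  \<comment> \<open>The bound \<open>p i \<le> 1\<close> serves the ranks below \<open>k\<close>,
    the rank bound all others; together they give \<open>p i * ?m \<le> k\<close>.\<close>
  have low: "r * p i \<le> sqrt k * (y i * sqrt (p i))" if i: "i < d" for i
  proof -
    let ?m = "max (real (s i) + 1) (real k)"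
    have "p i * ?m \<le> k"
    proof (cases "real (s i) + 1 \<le> k")
      case True
      then show ?thesis
        using orthonormal_coordinate_le_1[OF c i] mult_right_mono[of "p i" 1 "real k"]
        by (simp add: max_def p_def)
    next
      case False
      then show ?thesis using rank[OF i] by (simp add: max_def mult.commute)
    qed
    then have le: "sqrt (p i) * sqrt ?m \<le> sqrt k"
      by (simp flip: real_sqrt_mult)
    have "r * p i \<le> (y i * sqrt ?m) * p i"
      using r[OF sd[OF i]] p0 by (intro mult_right_mono) (auto simp: y_def)
    also have "\<dots> = (sqrt (p i) * sqrt ?m) * (y i * sqrt (p i))"
    proof -
      have "p i = sqrt (p i) * sqrt (p i)" using p0 by simp
      then show ?thesis by (metis mult.assoc mult.commute)
    qed
    also have "\<dots> \<le> sqrt k * (y i * sqrt (p i))"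
      using le y0[OF i] p0 by (intro mult_right_mono) auto
    finally show ?thesis .
  qed
  have "2 ^ k * (5 / 9 * (\<Sum>i<d. y i * sqrt (p i)))
      = (\<Sum>i<d. y i * (5 / 9 * 2 ^ k * sqrt (p i)))"
    by (simp add: sum_distrib_left mult_ac)
  \<comment> \<open>Khinchine is applied in each coordinate \<open>i\<close> to the numbers
    \<open>c j i\<close>, with the complex plane as a real inner product space.\<close>
  also have "\<dots> \<le> (\<Sum>i<d. y i * (\<Sum>A\<in>Pow {..<k}. cmod (?S A i)))"
    using y0 unfolding p_def by (intro sum_mono mult_left_mono khinchine_L1) auto
  also have "\<dots> = (\<Sum>A\<in>Pow {..<k}. \<Sum>i<d. y i * cmod (?S A i))"
    unfolding sum_distrib_left by (rule sum.swap)
  also have "\<dots> \<le> (\<Sum>A\<in>Pow {..<k}. 2 * (sqrt k * M))"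
    by (intro sum_mono M')
  also have "\<dots> = 2 ^ k * (2 * (sqrt k * M))" by (simp add: card_Pow)
  finally have fin: "5 / 9 * (\<Sum>i<d. y i * sqrt (p i)) \<le> 2 * (sqrt k * M)" by simp
  \<comment> \<open>The values \<open>p i\<close> sum to \<open>k\<close>, so the pointwise bounds
    \<open>low\<close> add up to a bound on \<open>r * k\<close>, and the factor \<open>k\<close>
    cancels at the end.\<close>
  have "r * k = (\<Sum>i<d. r * p i)"
    using sum_orthonormal_coordinates[OF c] by (simp add: p_def flip: sum_distrib_left)
  also have "\<dots> \<le> (\<Sum>i<d. sqrt k * (y i * sqrt (p i)))"
    by (intro sum_mono low) auto
  also have "\<dots> = sqrt k * (\<Sum>i<d. y i * sqrt (p i))" by (simp flip: sum_distrib_left)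
  also have "\<dots> \<le> sqrt k * (18 / 5 * (sqrt k * M))"
    using fin by (intro mult_left_mono) auto
  also have "\<dots> = 18 / 5 * M * k" by (simp add: algebra_simps)
  finally show ?thesis using k by simp
qed

section \<open>Complexification of real subspaces\<close>

lemma Re_cinner_to_complex: "Re (cinner d x (to_complex y)) = rinner d (\<lambda>i. Re (x i)) y"
  by (simp add: cinner_def rinner_def to_complex_def)

lemma cinner_to_complex_to_complex:
  "cinner d (to_complex x) (to_complex y) = complex_of_real (rinner d x y)"
  by (simp add: cinner_def rinner_def to_complex_def)

lemma cnorm_to_complex: "cnorm d (to_complex x) = rnorm d x"
  by (simp add: cnorm_def rnorm_def rinner_def to_complex_def power2_eq_square)

text \<open>\<open>V\<close> is the complex span of a real basis of \<open>W\<close>. The complex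
  projection also supplies existence and uniqueness of the real one, as the definite description in
  \<open>rproj\<close> requires.\<close>

lemma rproj_complexification:
  fixes W :: "(nat \<Rightarrow> real) set"
  assumes "ksubspace d k W"
  obtains V :: "(nat \<Rightarrow> complex) set" where "ksubspace d k V"
    "\<And>x. cproj d V (to_complex x) = to_complex (rproj d W x)"
proof -
  obtain b where b: "\<forall>j<k. b j \<in> coord_space d"
    and ind: "\<forall>a. lincomb k a b = (\<lambda>_. 0) \<longrightarrow> (\<forall>j<k. a j = 0)"
    and W: "W = range (\<lambda>a. lincomb k a b)"
    using assms unfolding ksubspace_def full_SetCompr_eq by blast
  define B where "B j = to_complex (b j)" for j
  define V where "V = range (\<lambda>a. lincomb k a B)"
  have Re: "(\<lambda>i. Re (lincomb k a B i)) = lincomb k (\<lambda>j. Re (a j)) b" for a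
    by (simp add: lincomb_def B_def to_complex_def)
  have Im: "(\<lambda>i. Im (lincomb k a B i)) = lincomb k (\<lambda>j. Im (a j)) b" for a
    by (simp add: lincomb_def B_def to_complex_def)
  have tc: "to_complex (lincomb k a b) = lincomb k (\<lambda>j. complex_of_real (a j)) B" for a
    by (simp add: lincomb_def B_def to_complex_def)
  \<comment> \<open>A complex dependence between real vectors splits into two real ones.\<close>
  have Bind: "a j = 0" if "lincomb k a B = (\<lambda>_. 0)" "j < k" for a j
  proof -
    have "Re (a j) = 0" using ind Re[of a] that by auto
    moreover have "Im (a j) = 0" using ind Im[of a] that by auto
    ultimately show ?thesis by (simp add: complex_eq_iff)
  qed
  have V: "ksubspace d k V"
    unfolding ksubspace_def full_SetCompr_eq
  proof (intro exI[of _ B] conjI allI impI)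
    fix j assume "j < k"
    then show "B j \<in> coord_space d" using b by (auto simp: B_def to_complex_def coord_space_def)
  qed (use Bind V_def in auto)
  show thesis
  proof (rule that[OF V])
    fix x
    obtain c where c: "orthonormal d k c" and Vc: "V = range (\<lambda>a. lincomb k a c)"
      using V by (rule ksubspace_orthonormal_basis)
    define q where "q = cproj d V (to_complex x)"
    have q: "q = lincomb k (\<lambda>j. cinner d (to_complex x) (c j)) c"
      unfolding q_def Vc by (rule cproj_orthonormal[OF c])
    then have qV: "q \<in> V" by (simp add: Vc)
    have qorth: "cinner d (\<lambda>i. to_complex x i - q i) v = 0" if "v \<in> V" for v
      using that unfolding Vc q
      by (auto simp: cinner_lincomb_right cinner_diff_left cinner_lincomb_orthonormal[OF c])
    \<comment> \<open>The real part of the complex projection is the candidate for the real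
      projection.\<close>
    define w where "w = (\<lambda>i. Re (q i))"
    have wW: "w \<in> W" using qV unfolding w_def V_def W by (auto simp: Re)
    have worth: "rinner d (\<lambda>i. x i - w i) v = 0" if "v \<in> W" for v
    proof -
      have "to_complex v \<in> V" using that unfolding W V_def by (auto simp: tc)
      then have "Re (cinner d (\<lambda>i. to_complex x i - q i) (to_complex v)) = 0"
        using qorth by simp
      then show ?thesis unfolding Re_cinner_to_complex by (simp add: w_def to_complex_def)
    qed
    \<comment> \<open>Every real candidate becomes the complex projection after embedding, so any
      two real candidates agree.\<close>
    have proj: "cproj d V (to_complex x) = to_complex w'"
      if w': "w' \<in> W" and orth: "\<forall>v\<in>W. rinner d (\<lambda>i. x i - w' i) v = 0" for w'
    proof (rule cproj_unique[OF V])
      show "to_complex w' \<in> V" using w' unfolding W V_def by (auto simp: tc)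
      have "cinner d (\<lambda>i. to_complex x i - to_complex w' i) (B j) = 0" if "j < k" for j
      proof -
        have "b j = lincomb k (\<lambda>l. if l = j then 1 else 0) b"
          using that by (simp add: lincomb_def if_distrib[where f = "\<lambda>t. t * _"] cong: if_cong)
        then have "b j \<in> W" unfolding W by blast
        moreover have "(\<lambda>i. to_complex x i - to_complex w' i) = to_complex (\<lambda>i. x i - w' i)"
          by (simp add: to_complex_def)
        ultimately show ?thesis using orth by (simp add: B_def cinner_to_complex_to_complex)
      qed
      then show "\<forall>v\<in>V. cinner d (\<lambda>i. to_complex x i - to_complex w' i) v = 0"
        by (auto simp: V_def cinner_lincomb_right)
    qed
    have "rproj d W x = w"
      unfolding rproj_def
    proof (rule the_equality)
      fix w' assume "w' \<in> W \<and> (\<forall>v\<in>W. rinner d (\<lambda>i. x i - w' i) v = 0)"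
      then have "to_complex w' = to_complex w"
        using proj[of w'] proj[of w] wW worth by simp
      then show "w' = w" by (simp add: to_complex_def fun_eq_iff)
    qed (use wW worth in auto)
    then show "cproj d V (to_complex x) = to_complex (rproj d W x)"
      using proj[of w] wW worth by simp
  qed
qed

section \<open>The truncated harmonic profile\<close>

text \<open>Induction on \<open>d\<close> from \<open>k\<close>, where all terms are
  \<open>1 / k\<close> and the sum is 1. Each later term \<open>1 / (n + 1)\<close> is at most the
  increment \<open>ln (n + 1) - ln n\<close>.\<close>

lemma sum_inverse_max_le:
  assumes "1 \<le> k" "k \<le> d"
  shows "(\<Sum>m<d. 1 / max (real m + 1) (real k)) \<le> 1 + ln (real d / real k)"
  using assms(2)
proof (induction rule: dec_induct)
  case base
  have "(\<Sum>m<k. 1 / max (real m + 1) (real k)) = (\<Sum>m<k. 1 / real k)"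
    by (intro sum.cong) (auto simp: max_def)
  then show ?case using assms(1) by simp
next
  case (step n)
  have n: "real n > 0" using step assms(1) by linarith
  \<comment> \<open>This is \<open>ln x \<le> x - 1\<close> at
    \<open>x = n / (n + 1)\<close>.\<close>
  have "ln (real n / (real n + 1)) \<le> real n / (real n + 1) - 1"
    using n by (intro ln_le_minus_one) auto
  also have "\<dots> = - (1 / (real n + 1))" using n by (simp add: field_simps)
  finally have "1 / (real n + 1) \<le> ln (real n + 1) - ln (real n)"
    using n by (simp add: ln_div)
  then show ?case
    using step n assms(1) by (simp add: max_def ln_div add.commute)
qed

section \<open>Normalisation, the absolute constant, and both kinds of subspaces\<close>

theorem theorem1p5:
  shows "\<exists>c::real. c > 0 \<and>
    (\<forall>d k :: nat. 1 \<le> k \<and> k \<le> d \<longrightarrow>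
      (\<exists>X. finite X \<and> X \<noteq> {} \<and> X \<subseteq> unit_sphere d \<and> transitive_set d X
         \<and> (\<forall>W :: (nat \<Rightarrow> real) set. ksubspace d k W \<longrightarrow>
              (SUP x\<in>X. rnorm d (rproj d W x)) \<ge> c / sqrt (ln (2 * real d / real k)))
         \<and> (\<forall>W :: (nat \<Rightarrow> complex) set. ksubspace d k W \<longrightarrow>
              (SUP x\<in>X. cnorm d (cproj d W (to_complex x))) \<ge> c / sqrt (ln (2 * real d / real k)))))"
proof (intro exI[of _ "1 / 10"] conjI allI impI; (elim conjE)?)
  fix d k :: nat assume k: "1 \<le> k" "k \<le> d"
  define H where "H = (\<Sum>m<d. 1 / max (real m + 1) (real k))"
  define L where "L = ln (2 * real d / real k)"
  \<comment> \<open>The factor \<open>H\<close> makes the squares of the entries sum to 1.\<close>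
  define u where "u m = 1 / sqrt (H * max (real m + 1) (real k))" for m
  define X where "X = signed_perms d u"
  have H0: "H > 0"
    unfolding H_def using k by (intro sum_pos) (auto simp: lessThan_empty_iff)
  have "L = ln 2 + ln (real d / real k)"
    using k by (simp add: L_def ln_div ln_mult)
  moreover have "ln (real d / real k) \<ge> 0" using k by simp
  \<comment> \<open>\<open>H\<close> is at most \<open>1 + ln (d / k)\<close>, and the summand 1 is
    absorbed by \<open>2 * ln 2\<close>; the 2 inside the logarithm thus covers the case
    \<open>d = k\<close>.\<close>
  ultimately have HL: "H \<le> 2 * L"
    using sum_inverse_max_le[OF k] ln2_ge_two_thirds unfolding H_def by linarith
  have u2: "(u m)\<^sup>2 = 1 / max (real m + 1) (real k) / H" for m
    using H0 by (simp add: u_def power_divide real_sqrt_pow2 max_def)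
  have sphere: "X \<subseteq> unit_sphere d"
    unfolding X_def
    by (rule signed_perms_unit_sphere)
      (unfold u2 sum_divide_distrib[symmetric] H_def[symmetric], use H0 in simp)
  \<comment> \<open>After clearing denominators the claim is
    \<open>9 * sqrt H \<le> 25 * sqrt L\<close>, which leaves room beyond
    \<open>sqrt H \<le> 2 * sqrt L\<close>.\<close>
  have const: "1 / 10 / sqrt L \<le> 5 / 18 * (1 / sqrt H)"
  proof -
    have "sqrt H \<le> sqrt (2 * L)" using HL by simp
    also have "\<dots> = sqrt 2 * sqrt L" by (simp add: real_sqrt_mult)
    also have "\<dots> \<le> 2 * sqrt L"
      using HL H0 by (intro mult_right_mono real_le_lsqrt) auto
    finally have "sqrt H \<le> 2 * sqrt L" .
    moreover have "sqrt H > 0" "sqrt L > 0" using H0 HL by auto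
    moreover from calculation have "9 * sqrt H \<le> 25 * sqrt L" by linarith
    ultimately show ?thesis by (simp add: field_simps)
  qed
  have width: "1 / 10 / sqrt L \<le> M"
    if W: "ksubspace d k W" and M: "\<And>x. x \<in> X \<Longrightarrow> cnorm d (cproj d W (to_complex x)) \<le> M" for W M
  proof -
    have "5 / 18 * (1 / sqrt H) \<le> M"
    proof (rule signed_perms_width_complex[OF k(1) W])
      fix m
      show "u m \<ge> 0" using H0 by (simp add: u_def)
      have "max (real m + 1) (real k) > 0" by (simp add: max_def)
      then show "1 / sqrt H \<le> u m * sqrt (max (real m + 1) (real k))"
        by (simp add: u_def real_sqrt_mult)
    qed (use M in \<open>simp add: X_def\<close>)
    then show ?thesis using const by linarith
  qed
  have X: "finite X" "X \<noteq> {}"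
    by (simp_all add: X_def finite_signed_perms signed_perms_nonempty)
  \<comment> \<open>Finiteness of \<open>X\<close> bounds the set of norms, so its supremum is an
    admissible \<open>M\<close>.\<close>
  have complex: "1 / 10 / sqrt L \<le> (SUP x\<in>X. cnorm d (cproj d W (to_complex x)))"
    if "ksubspace d k W" for W
    using X by (intro width[OF that] cSUP_upper) auto
  have real: "1 / 10 / sqrt L \<le> (SUP x\<in>X. rnorm d (rproj d W x))"
    if W: "ksubspace d k W" for W :: "(nat \<Rightarrow> real) set"
  proof -
    obtain V :: "(nat \<Rightarrow> complex) set" where V: "ksubspace d k V"
      "\<And>x. cproj d V (to_complex x) = to_complex (rproj d W x)"
      using rproj_complexification[OF W] by blast
    \<comment> \<open>Embedding preserves norms, so the real and the complex supremum
      coincide.\<close>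
    show ?thesis using complex[OF V(1)] by (simp add: V(2) cnorm_to_complex)
  qed
  show "\<exists>X. finite X \<and> X \<noteq> {} \<and> X \<subseteq> unit_sphere d \<and> transitive_set d X
         \<and> (\<forall>W :: (nat \<Rightarrow> real) set. ksubspace d k W \<longrightarrow>
              (SUP x\<in>X. rnorm d (rproj d W x)) \<ge> 1 / 10 / sqrt (ln (2 * real d / real k)))
         \<and> (\<forall>W :: (nat \<Rightarrow> complex) set. ksubspace d k W \<longrightarrow>
              (SUP x\<in>X. cnorm d (cproj d W (to_complex x))) \<ge> 1 / 10 / sqrt (ln (2 * real d / real k)))"
    using X sphere transitive_signed_perms[of d u] complex real
    unfolding L_def[symmetric] X_def[symmetric] by blast
qed simp

end
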